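(* Let $0<s<1$, $0\le\alpha<s$, and let $S\subset\mathbb{R}^n$ be a (bounded) domain which is star-shaped with respect to a ball $B$. Then there exists a constant $C$, depending on $S$ only through its chunkiness parameter $d_S/d_B$ (and on $n,s,\alpha$), such that for every $v\in L^2(S)$ with $\int_Sv=0$, $$\|v\|_{L^2(S)}\le C\,d_S^{\,s-\alpha}\,|v|_{H^s_\alpha(S)}.$$
   Context: $d_S$ and $d_B$ are the diameters of $S$ and $B$; the chunkiness parameter of $S$ is $d_S/d_B$. With $\delta(x)=\mathrm{dist}(x,\partial S)$ and $\delta(x,y)=\min\{\delta(x),\delta(y)\}$, $$|v|_{H^s_\alpha(S)}^2=\iint_{S\times S}\frac{|v(x)-v(y)|^2}{|x-y|^{n+2s}}\,\delta(x,y)^{2\alpha}\,dx\,dy$$ (possibly $+\infty$). $S$ is star-shaped with respect to $B$ if $B\subset S$ and for every $x\in S$ the convex hull of $\{x\}\cup B$ is contained in $S$. *)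

theory Defs
  imports "HOL-Analysis.Analysis"
begin

definition bounded_domain :: "'a::euclidean_space set \<Rightarrow> bool" where
  "bounded_domain S \<longleftrightarrow> S \<noteq> {} \<and> open S \<and> connected S \<and> bounded S"

definition star_shaped_wrt :: "'a::euclidean_space set \<Rightarrow> 'a set \<Rightarrow> bool" where
  "star_shaped_wrt S B \<longleftrightarrow> B \<subseteq> S \<and> (\<forall>x\<in>S. convex hull (insert x B) \<subseteq> S)"

definition chunkiness :: "'a::euclidean_space set \<Rightarrow> 'a set \<Rightarrow> real" where
  "chunkiness S B = diameter S / diameter B"

definition bdist :: "'a::euclidean_space set \<Rightarrow> 'a \<Rightarrow> real" where
  "bdist S x = infdist x (frontier S)"

definition bdist2 :: "'a::euclidean_space set \<Rightarrow> 'a \<Rightarrow> 'a \<Rightarrow> real" where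
  "bdist2 S x y = min (bdist S x) (bdist S y)"

definition L2_on :: "'a::euclidean_space set \<Rightarrow> ('a \<Rightarrow> real) \<Rightarrow> bool" where
  "L2_on S v \<longleftrightarrow> v \<in> borel_measurable (lebesgue_on S) \<and> integrable (lebesgue_on S) (\<lambda>x. (v x)\<^sup>2)"

definition L2_norm_on :: "'a::euclidean_space set \<Rightarrow> ('a \<Rightarrow> real) \<Rightarrow> real" where
  "L2_norm_on S v = sqrt (\<integral>x. (v x)\<^sup>2 \<partial>lebesgue_on S)"

text \<open>The squared seminorm, with values in \<open>[0, \<infinity>]\<close>. On the diagonal the integrand is \<open>0\<close>
  (division by \<open>0\<close>), but the diagonal is a null set. For open \<open>S\<close> and \<open>x, y\<close> in \<open>S\<close>
  the base of the weight is positive, so the convention \<open>0 powr 0 = 0\<close> plays no role when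
  \<open>\<alpha> = 0\<close>.\<close>

definition Hs_seminorm_sq :: "real \<Rightarrow> real \<Rightarrow> 'a::euclidean_space set \<Rightarrow> ('a \<Rightarrow> real) \<Rightarrow> ennreal" where
  "Hs_seminorm_sq s \<alpha> S v =
     (\<integral>\<^sup>+(x, y). ennreal (\<bar>v x - v y\<bar>\<^sup>2 / norm (x - y) powr (real DIM('a) + 2 * s)
                          * bdist2 S x y powr (2 * \<alpha>))
        \<partial>(lebesgue_on S \<Otimes>\<^sub>M lebesgue_on S))"

definition Hs_seminorm :: "real \<Rightarrow> real \<Rightarrow> 'a::euclidean_space set \<Rightarrow> ('a \<Rightarrow> real) \<Rightarrow> ennreal" where
  "Hs_seminorm s \<alpha> S v =
     (if Hs_seminorm_sq s \<alpha> S v = \<infinity> then \<infinity>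
      else ennreal (sqrt (enn2real (Hs_seminorm_sq s \<alpha> S v))))"

end

theory Submission
  imports Defs
begin

text \<open>Write \<open>B = ball c r\<close>, \<open>B' = ball c (r / 2)\<close>, \<open>n\<close> for the dimension, \<open>d\<close> for the diameter of \<open>S\<close>,
  \<open>\<delta>\<close> for the distance to the boundary (\<open>bdist S\<close>) and \<open>\<sigma> = s - \<alpha> > 0\<close>. Since \<open>v\<close> has mean zero, its squared \<open>L\<^sup>2\<close> norm is at most the integral of
  \<open>(v x - v b)\<^sup>2\<close> over \<open>x \<in> S\<close>, for each constant \<open>v b\<close>. Averaging over \<open>b \<in> B'\<close>, it suffices to
  bound \<open>\<integral>\<^sub>S \<integral>\<^sub>B\<^sub>' (v x - v b)\<^sup>2 db dx\<close> by the seminorm.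

  To compare \<open>v x\<close> with \<open>v b\<close>, run along the segment from \<open>b\<close> to \<open>x\<close> in dyadic steps. Put
  \<open>x\<^sub>t = (1 - t) x + t b\<close>. Star-shapedness gives \<open>\<delta>(x\<^sub>t) \<ge> t r / 2\<close>, so the weight
  \<open>\<delta>\<^sup>2\<^sup>\<alpha>\<close> is at least of order \<open>(t r)\<^sup>2\<^sup>\<alpha>\<close> at both \<open>x\<^sub>t\<close> and the midpoint \<open>x\<^bsub>t/2\<^esub>\<close> of \<open>x\<close> and
  \<open>x\<^sub>t\<close>, whose distance is at most \<open>t d\<close>. The map \<open>(x, b) \<mapsto> (x\<^bsub>t/2\<^esub>, x\<^sub>t)\<close> is linear with Jacobian
  \<open>(t / 2)\<^sup>n\<close>; hence the integral of \<open>(v x\<^bsub>t/2\<^esub> - v x\<^sub>t)\<^sup>2\<close> is at most a constant times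
  \<open>t\<^bsup>n + 2s\<^esup> t\<^bsup>- 2\<alpha>\<^esup> t\<^bsup>- n\<^esup> = t\<^bsup>2\<sigma>\<^esup>\<close> times the squared seminorm
  (\<open>rescaled_difference_le_energy\<close>). Because \<open>\<sigma> > 0\<close> these contributions decay geometrically along
  \<open>t = 1, 1/2, 1/4, \<dots>\<close> and can be summed (\<open>oscillation_halving\<close>, \<open>oscillation_deep_part_le\<close>).

  The chain has to end somewhere. On the set where \<open>\<delta>(x) \<ge> r / 2\<^sup>k\<close> it ends at level \<open>k\<close>, since there
  \<open>(v x - v x\<^sub>t)\<^sup>2\<close> with \<open>t = 1 / 2\<^sup>k\<close> obeys the same estimate directly. The resulting bound does not depend
  on \<open>k\<close>, and these sets exhaust \<open>S\<close>, so monotone convergence finishes the proof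
  (\<open>oscillation_le_energy\<close>) without any convergence of \<open>v x\<^sub>t\<close> to \<open>v x\<close>. Dividing by the volume
  of \<open>B'\<close> produces the power \<open>(d / r)\<^bsup>n + 2\<alpha>\<^esup>\<close> of the chunkiness parameter (\<open>variance_le_energy\<close>).\<close>

section \<open>Elementary inequalities\<close>

text \<open>The weighted form of the triangle inequality lets the factor in front of \<open>a\<^sup>2\<close> be as close
  to \<open>1\<close> as needed, which is what keeps an iterated estimate geometric.\<close>
lemma power2_add_le_weighted:
  fixes a b q :: real
  assumes "1 < q"
  shows "(a + b)\<^sup>2 \<le> q * a\<^sup>2 + q / (q - 1) * b\<^sup>2"
proof -
  have "q * a\<^sup>2 + q / (q - 1) * b\<^sup>2 - (a + b)\<^sup>2 = ((q - 1) * a - b)\<^sup>2 / (q - 1)"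
    using assms by (simp add: field_simps power2_eq_square)
  moreover have "0 \<le> ((q - 1) * a - b)\<^sup>2 / (q - 1)" using assms by simp
  ultimately show ?thesis by linarith
qed

text \<open>Among all constants, the mean is the best approximation in \<open>L\<^sup>2\<close>: the cross term in the
  expanded square integrates to zero.\<close>
lemma nn_integral_variance_ge:
  fixes v :: "'a \<Rightarrow> real"
  assumes "finite_measure M" and v: "v \<in> borel_measurable M"
    and v2: "integrable M (\<lambda>x. (v x)\<^sup>2)" and mean: "(\<integral>x. v x \<partial>M) = 0"
  shows "ennreal (\<integral>x. (v x)\<^sup>2 \<partial>M) \<le> (\<integral>\<^sup>+x. ennreal ((v x - a)\<^sup>2) \<partial>M)"
proof -
  interpret finite_measure M by fact
  have v1: "integrable M v"
    using square_integrable_imp_integrable[OF v v2] .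
  have eq: "(v x - a)\<^sup>2 = (v x)\<^sup>2 - 2 * a * v x + a\<^sup>2" for x
    by (simp add: power2_eq_square algebra_simps)
  have "(\<integral>x. (v x)\<^sup>2 \<partial>M) \<le> (\<integral>x. (v x - a)\<^sup>2 \<partial>M)"
    unfolding eq using v1 v2 mean by simp
  moreover have "integrable M (\<lambda>x. (v x - a)\<^sup>2)"
    unfolding eq using v1 v2 by simp
  ultimately show ?thesis
    by (simp add: nn_integral_eq_integral ennreal_leI)
qed

lemma ennreal_mult_mult_left:
  "0 \<le> a \<Longrightarrow> 0 \<le> b \<Longrightarrow> ennreal a * (ennreal b * H) = ennreal (a * b) * H"
  by (simp add: ennreal_mult mult.assoc)

section \<open>Linear substitutions\<close>

lemma nn_integral_lborel_affine:
  fixes g :: "'a::euclidean_space \<Rightarrow> ennreal"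
  assumes [measurable]: "g \<in> borel_measurable borel" and m: "0 < m"
  shows "(\<integral>\<^sup>+x. g (a + m *\<^sub>R x) \<partial>lborel) = ennreal (1 / m ^ DIM('a)) * (\<integral>\<^sup>+x. g x \<partial>lborel)"
proof -
  have "(\<integral>\<^sup>+x. g x \<partial>lborel)
      = (\<integral>\<^sup>+x. g x \<partial>density (distr lborel borel (\<lambda>x. a + m *\<^sub>R x)) (\<lambda>_. ennreal (\<bar>m\<bar> ^ DIM('a))))"
    using lborel_affine[of m a] m by simp
  also have "\<dots> = ennreal (m ^ DIM('a)) * (\<integral>\<^sup>+x. g (a + m *\<^sub>R x) \<partial>lborel)"
    using m by (simp add: nn_integral_density nn_integral_distr nn_integral_cmult)
  finally have "ennreal (1 / m ^ DIM('a)) * (\<integral>\<^sup>+x. g x \<partial>lborel)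
      = ennreal (1 / m ^ DIM('a)) * ennreal (m ^ DIM('a)) * (\<integral>\<^sup>+x. g (a + m *\<^sub>R x) \<partial>lborel)"
    by (simp add: mult.assoc)
  also have "ennreal (1 / m ^ DIM('a)) * ennreal (m ^ DIM('a)) = 1"
    using m by (simp add: ennreal_mult[symmetric] del: power_one_over)
  finally show ?thesis by simp
qed

text \<open>With \<open>z = (1 - t) x + t b\<close> and \<open>y = (1 - l) x + l z\<close>, the linear map \<open>(x, b) \<mapsto> (y, z)\<close> is
  triangular: for fixed \<open>x\<close> the variable \<open>b\<close> is replaced by \<open>z\<close>, and then for fixed \<open>z\<close> the variable
  \<open>x\<close> by \<open>y\<close>. The case \<open>l = 0\<close> pairs \<open>x\<close> with the point \<open>z\<close>, the case \<open>l = 1 / 2\<close> pairs the midpoint of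
  \<open>x\<close> and \<open>z\<close> with \<open>z\<close>.\<close>
lemma nn_integral_segment_substitution:
  fixes \<Phi> :: "'a::euclidean_space \<times> 'a \<Rightarrow> ennreal"
  assumes \<Phi>[measurable]: "\<Phi> \<in> borel_measurable (borel \<Otimes>\<^sub>M borel)"
    and t: "0 < t" and l: "0 \<le> l" "l < 1"
  shows "(\<integral>\<^sup>+x. \<integral>\<^sup>+b. \<Phi> ((1 - l) *\<^sub>R x + l *\<^sub>R ((1 - t) *\<^sub>R x + t *\<^sub>R b),
                           (1 - t) *\<^sub>R x + t *\<^sub>R b) \<partial>lborel \<partial>lborel)
       = ennreal (1 / (t * (1 - l)) ^ DIM('a)) * (\<integral>\<^sup>+y. \<integral>\<^sup>+z. \<Phi> (y, z) \<partial>lborel \<partial>lborel)"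
proof -
  let ?T = "ennreal (1 / t ^ DIM('a))" and ?L = "ennreal (1 / (1 - l) ^ DIM('a))"
  have sub_b: "(\<integral>\<^sup>+b. \<Phi> ((1 - l) *\<^sub>R x + l *\<^sub>R ((1 - t) *\<^sub>R x + t *\<^sub>R b),
                       (1 - t) *\<^sub>R x + t *\<^sub>R b) \<partial>lborel)
      = ?T * (\<integral>\<^sup>+z. \<Phi> ((1 - l) *\<^sub>R x + l *\<^sub>R z, z) \<partial>lborel)" for x
    by (rule nn_integral_lborel_affine[where g = "\<lambda>z. \<Phi> ((1 - l) *\<^sub>R x + l *\<^sub>R z, z)", OF _ t])
       measurable
  have sub_x: "(\<integral>\<^sup>+x. \<Phi> ((1 - l) *\<^sub>R x + l *\<^sub>R z, z) \<partial>lborel)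
      = ?L * (\<integral>\<^sup>+y. \<Phi> (y, z) \<partial>lborel)" for z
    using nn_integral_lborel_affine[of "\<lambda>y. \<Phi> (y, z)" "1 - l" "l *\<^sub>R z"] l
    by (simp add: add.commute)
  have "(\<integral>\<^sup>+x. \<integral>\<^sup>+b. \<Phi> ((1 - l) *\<^sub>R x + l *\<^sub>R ((1 - t) *\<^sub>R x + t *\<^sub>R b),
                           (1 - t) *\<^sub>R x + t *\<^sub>R b) \<partial>lborel \<partial>lborel)
      = ?T * (\<integral>\<^sup>+x. \<integral>\<^sup>+z. \<Phi> ((1 - l) *\<^sub>R x + l *\<^sub>R z, z) \<partial>lborel \<partial>lborel)"
    unfolding sub_b by (rule nn_integral_cmult) measurable
  also have "(\<integral>\<^sup>+x. \<integral>\<^sup>+z. \<Phi> ((1 - l) *\<^sub>R x + l *\<^sub>R z, z) \<partial>lborel \<partial>lborel)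
      = (\<integral>\<^sup>+z. \<integral>\<^sup>+x. \<Phi> ((1 - l) *\<^sub>R x + l *\<^sub>R z, z) \<partial>lborel \<partial>lborel)"
    by (rule lborel_pair.Fubini') measurable
  also have "\<dots> = ?L * (\<integral>\<^sup>+z. \<integral>\<^sup>+y. \<Phi> (y, z) \<partial>lborel \<partial>lborel)"
    unfolding sub_x by (rule nn_integral_cmult) measurable
  also have "(\<integral>\<^sup>+z. \<integral>\<^sup>+y. \<Phi> (y, z) \<partial>lborel \<partial>lborel) = (\<integral>\<^sup>+y. \<integral>\<^sup>+z. \<Phi> (y, z) \<partial>lborel \<partial>lborel)"
    by (rule lborel_pair.Fubini') measurable
  also have "?T * (?L * (\<integral>\<^sup>+y. \<integral>\<^sup>+z. \<Phi> (y, z) \<partial>lborel \<partial>lborel))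
      = ennreal (1 / (t * (1 - l)) ^ DIM('a)) * (\<integral>\<^sup>+y. \<integral>\<^sup>+z. \<Phi> (y, z) \<partial>lborel \<partial>lborel)"
    using t l
    by (simp add: mult.assoc[symmetric] ennreal_mult[symmetric] power_mult_distrib del: power_one_over)
  finally show ?thesis .
qed

section \<open>Distance to the boundary in a star-shaped domain\<close>

lemma bdist_ge_of_ball_subset:
  fixes S :: "'a::euclidean_space set"
  assumes S: "bounded_domain S" and ball: "ball z \<rho> \<subseteq> S"
  shows "\<rho> \<le> bdist S z"
proof -
  \<comment> \<open>An empty frontier would make \<open>infdist\<close> equal to \<open>0\<close> by convention.\<close>
  have ne: "frontier S \<noteq> {}"
    using S frontier_not_empty[of S] not_bounded_UNIV unfolding bounded_domain_def by metis
  moreover have "\<rho> \<le> dist z y" if "y \<in> frontier S" for y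
  proof -
    have "y \<notin> S"
      using that S by (auto simp: bounded_domain_def frontier_def interior_open)
    then show ?thesis using ball by (auto simp: not_le[symmetric])
  qed
  ultimately show ?thesis
    unfolding bdist_def infdist_def by (auto intro: cINF_greatest)
qed

text \<open>The homothety \<open>w \<mapsto> (1 - t) x + t w\<close> maps \<open>B\<close> into \<open>S\<close>; as \<open>ball b (r / 2)\<close> is contained in
  \<open>B\<close>, its image, a ball of radius \<open>t r / 2\<close>, lies in \<open>S\<close> as well.\<close>
lemma star_shaped_ball_subset:
  fixes S :: "'a::euclidean_space set"
  assumes star: "star_shaped_wrt S (ball c r)" and x: "x \<in> S"
    and b: "b \<in> ball c (r / 2)" and t: "0 < t" "t \<le> 1"
  shows "ball ((1 - t) *\<^sub>R x + t *\<^sub>R b) (t * r / 2) \<subseteq> S"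
proof
  fix y assume y: "y \<in> ball ((1 - t) *\<^sub>R x + t *\<^sub>R b) (t * r / 2)"
  define w where "w = (1 / t) *\<^sub>R (y - (1 - t) *\<^sub>R x)"
  have y_eq: "y = (1 - t) *\<^sub>R x + t *\<^sub>R w"
    using t by (simp add: w_def)
  have "t * dist b w = dist ((1 - t) *\<^sub>R x + t *\<^sub>R b) y"
    using t by (simp add: y_eq dist_norm scaleR_diff_right[symmetric])
  also have "\<dots> < t * (r / 2)" using y by simp
  finally have "dist b w < r / 2" using t by simp
  then have "w \<in> ball c r"
    using b dist_triangle[of c w b] by simp
  moreover have "convex hull (insert x (ball c r)) \<subseteq> S"
    using star x by (simp add: star_shaped_wrt_def)
  ultimately show "y \<in> S"
    using t unfolding y_eq
    by (intro subsetD[OF _ convexD_alt[OF convex_convex_hull]]) (auto intro: hull_inc)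
qed

lemma borel_measurable_bdist [measurable]: "bdist S \<in> borel_measurable borel"
  unfolding bdist_def by (intro borel_measurable_continuous_onI continuous_intros)

section \<open>Differences along segments towards the ball\<close>

text \<open>The function is taken Borel measurable on the whole space, so that its compositions with
  affine maps are measurable; a general \<open>v\<close> is replaced by a Borel representative at the end.\<close>
locale star_domain =
  fixes S :: "'a::euclidean_space set" and c :: 'a and r s \<alpha> :: real and f :: "'a \<Rightarrow> real"
  assumes domain: "bounded_domain S" and r_pos: "0 < r" and star: "star_shaped_wrt S (ball c r)"
    and \<alpha>_nonneg: "0 \<le> \<alpha>" and \<alpha>_less: "\<alpha> < s"
    and f_borel [measurable]: "f \<in> borel_measurable borel"
begin

definition kernel :: "'a \<times> 'a \<Rightarrow> ennreal" where
  "kernel = (\<lambda>(y, z). ennreal (\<bar>f y - f z\<bar>\<^sup>2 / norm (y - z) powr (real DIM('a) + 2 * s)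
                                 * bdist2 S y z powr (2 * \<alpha>)))"

definition energy :: ennreal where
  "energy = (\<integral>\<^sup>+y\<in>S. (\<integral>\<^sup>+z\<in>S. kernel (y, z) \<partial>lborel) \<partial>lborel)"

text \<open>Only \<open>b\<close> in the concentric ball of half the radius is used: it leaves room for a ball of
  radius \<open>t r / 2\<close> around each point \<open>(1 - t) x + t b\<close>.\<close>
definition oscillation :: "'a set \<Rightarrow> real \<Rightarrow> ennreal" where
  "oscillation A t = (\<integral>\<^sup>+x\<in>A. (\<integral>\<^sup>+b\<in>ball c (r / 2).
     ennreal ((f x - f ((1 - t) *\<^sub>R x + t *\<^sub>R b))\<^sup>2) \<partial>lborel) \<partial>lborel)"

text \<open>The constant of the one-scale estimate: \<open>d\<^bsup>n + 2s\<^esup>\<close> comes from the kernel, \<open>(r / 4)\<^bsup>- 2\<alpha>\<^esup>\<close>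
  from the weight, and \<open>2\<^sup>n\<close> from the Jacobian.\<close>
definition scale_const :: real where
  "scale_const = 2 ^ DIM('a) * diameter S powr (real DIM('a) + 2 * s) * (r / 4) powr (- 2 * \<alpha>)"

lemma scale_const_nonneg: "0 \<le> scale_const"
  by (simp add: scale_const_def)

lemma kernel_borel [measurable]: "kernel \<in> borel_measurable (borel \<Otimes>\<^sub>M borel)"
  unfolding kernel_def bdist2_def by measurable

lemma S_borel [measurable]: "S \<in> sets borel"
  using domain by (simp add: bounded_domain_def)

lemma pred_half_ball [measurable]: "Measurable.pred borel (\<lambda>x. x \<in> ball c (r / 2))"
  unfolding pred_def by simp

lemma dist_le_diameter: "x \<in> S \<Longrightarrow> y \<in> S \<Longrightarrow> norm (x - y) \<le> diameter S"
  using domain diameter_bounded_bound[of S x y] by (simp add: bounded_domain_def dist_norm)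

lemma ball_subset: "ball c r \<subseteq> S"
  using star by (simp add: star_shaped_wrt_def)

lemma half_ball_subset: "ball c (r / 2) \<subseteq> S"
  using ball_subset r_pos by (force simp: subset_iff)

lemma two_r_le_diameter: "2 * r \<le> diameter S"
  using diameter_subset[OF ball_subset] domain r_pos by (simp add: bounded_domain_def)

lemma diameter_pos: "0 < diameter S"
  using two_r_le_diameter r_pos by linarith

lemma segment_bdist_ge:
  assumes "x \<in> S" "b \<in> ball c (r / 2)" "0 < t" "t \<le> 1"
  shows "t * r / 2 \<le> bdist S ((1 - t) *\<^sub>R x + t *\<^sub>R b)"
  by (rule bdist_ge_of_ball_subset[OF domain star_shaped_ball_subset[OF star assms]])

lemma segment_in:
  assumes "x \<in> S" "b \<in> ball c (r / 2)" "0 < t" "t \<le> 1"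
  shows "(1 - t) *\<^sub>R x + t *\<^sub>R b \<in> S"
  using star_shaped_ball_subset[OF star assms] assms(3) r_pos by (auto simp: subset_iff)

text \<open>The kernel is the squared difference divided by a power of the distance and multiplied by
  the weight; both factors are controlled by the scale \<open>t\<close>.\<close>
lemma sq_diff_le_kernel:
  assumes near: "norm (y - z) \<le> t * diameter S" and t: "0 < t"
    and deep: "t * r / 4 \<le> bdist S y" "t * r / 4 \<le> bdist S z"
  shows "ennreal ((f y - f z)\<^sup>2) \<le>
    ennreal ((t * diameter S) powr (real DIM('a) + 2 * s) * (t * r / 4) powr (- 2 * \<alpha>)) * kernel (y, z)"
proof (cases "y = z")
  case False
  let ?p = "real DIM('a) + 2 * s" and ?D = "bdist2 S y z"
  have p: "0 \<le> ?p" using \<alpha>_nonneg \<alpha>_less by simp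
  have pos: "0 < norm (y - z)" "0 < t * r / 4" using False t r_pos by auto
  have D: "t * r / 4 \<le> ?D" using deep by (simp add: bdist2_def)
  have "(f y - f z)\<^sup>2 = (norm (y - z) powr ?p * ?D powr (- 2 * \<alpha>)) *
      (\<bar>f y - f z\<bar>\<^sup>2 / norm (y - z) powr ?p * ?D powr (2 * \<alpha>))"
    using pos D by (simp add: powr_minus field_simps)
  also have "\<dots> \<le> ((t * diameter S) powr ?p * (t * r / 4) powr (- 2 * \<alpha>)) *
      (\<bar>f y - f z\<bar>\<^sup>2 / norm (y - z) powr ?p * ?D powr (2 * \<alpha>))"
    using near pos D p \<alpha>_nonneg
    by (intro mult_right_mono mult_mono powr_mono2 powr_mono2') auto
  finally show ?thesis
    by (simp add: kernel_def ennreal_mult[symmetric] ennreal_leI)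
qed simp

text \<open>The estimate at a single scale \<open>t\<close>. Pointwise the squared difference is at most
  a constant times \<open>t\<^bsup>n + 2s - 2\<alpha>\<^esup>\<close> times the kernel at the two points, and the substitution of these points for
  \<open>(x, b)\<close> costs \<open>t\<^bsup>- n\<^esup>\<close>. It is applied with \<open>l = 1 / 2\<close> for the steps of the chain and with \<open>l = 0\<close> for
  its last link, where the depth of \<open>x\<close> itself has to be known.\<close>
lemma rescaled_difference_le_energy:
  assumes A [measurable]: "A \<in> sets borel" and AS: "A \<subseteq> S"
    and t: "0 < t" "t \<le> 1" and l: "0 \<le> l" "l \<le> 1 / 2"
    and inside: "\<And>x b. x \<in> A \<Longrightarrow> b \<in> ball c (r / 2) \<Longrightarrow>
      (1 - l) *\<^sub>R x + l *\<^sub>R ((1 - t) *\<^sub>R x + t *\<^sub>R b) \<in> S"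
    and deep: "\<And>x b. x \<in> A \<Longrightarrow> b \<in> ball c (r / 2) \<Longrightarrow>
      t * r / 4 \<le> bdist S ((1 - l) *\<^sub>R x + l *\<^sub>R ((1 - t) *\<^sub>R x + t *\<^sub>R b))"
  shows "(\<integral>\<^sup>+x\<in>A. (\<integral>\<^sup>+b\<in>ball c (r / 2).
      ennreal ((f ((1 - l) *\<^sub>R x + l *\<^sub>R ((1 - t) *\<^sub>R x + t *\<^sub>R b))
               - f ((1 - t) *\<^sub>R x + t *\<^sub>R b))\<^sup>2) \<partial>lborel) \<partial>lborel)
    \<le> ennreal (scale_const * t powr (2 * (s - \<alpha>))) * energy"
proof -
  let ?z = "\<lambda>x b. (1 - t) *\<^sub>R x + t *\<^sub>R b"
  let ?y = "\<lambda>x b. (1 - l) *\<^sub>R x + l *\<^sub>R ?z x b"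
  let ?p = "real DIM('a) + 2 * s"
  define K where "K = (t * diameter S) powr ?p * (t * r / 4) powr (- 2 * \<alpha>)"
  have K: "0 \<le> K" by (simp add: K_def)
  define \<Phi> where "\<Phi> = (\<lambda>w::'a \<times> 'a. kernel w * indicator S (fst w) * indicator S (snd w))"
  have \<Phi>_borel [measurable]: "\<Phi> \<in> borel_measurable (borel \<Otimes>\<^sub>M borel)"
    unfolding \<Phi>_def by measurable
  have point: "ennreal ((f (?y x b) - f (?z x b))\<^sup>2) \<le> ennreal K * \<Phi> (?y x b, ?z x b)"
    if x: "x \<in> A" and b: "b \<in> ball c (r / 2)" for x b
  proof -
    have xS: "x \<in> S" and bS: "b \<in> S" using x b AS half_ball_subset by auto
    have "?y x b - ?z x b = ((1 - l) * t) *\<^sub>R (x - b)"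
      by (simp add: algebra_simps)
    then have "norm (?y x b - ?z x b) = (1 - l) * (t * norm (x - b))"
      using t l by simp
    also have "\<dots> \<le> 1 * (t * diameter S)"
      using t l dist_le_diameter[OF xS bS] by (intro mult_mono) auto
    finally have near: "norm (?y x b - ?z x b) \<le> t * diameter S" by simp
    have "t * r / 4 \<le> bdist S (?z x b)"
      using segment_bdist_ge[OF xS b t] mult_pos_pos[OF t(1) r_pos] by linarith
    then show ?thesis
      using sq_diff_le_kernel[OF near t(1) deep[OF x b]] inside[OF x b] segment_in[OF xS b t]
      by (simp add: \<Phi>_def K_def)
  qed
  have "(\<integral>\<^sup>+x\<in>A. (\<integral>\<^sup>+b\<in>ball c (r / 2). ennreal ((f (?y x b) - f (?z x b))\<^sup>2) \<partial>lborel) \<partial>lborel)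
      \<le> (\<integral>\<^sup>+x. \<integral>\<^sup>+b. ennreal K * \<Phi> (?y x b, ?z x b) \<partial>lborel \<partial>lborel)"
  proof (rule nn_integral_mono)
    fix x :: 'a
    show "(\<integral>\<^sup>+b\<in>ball c (r / 2). ennreal ((f (?y x b) - f (?z x b))\<^sup>2) \<partial>lborel) * indicator A x
        \<le> (\<integral>\<^sup>+b. ennreal K * \<Phi> (?y x b, ?z x b) \<partial>lborel)"
    proof (cases "x \<in> A")
      case True
      then show ?thesis
        by (auto intro!: nn_integral_mono point split: split_indicator)
    qed simp
  qed
  also have "\<dots> = ennreal K * (\<integral>\<^sup>+x. \<integral>\<^sup>+b. \<Phi> (?y x b, ?z x b) \<partial>lborel \<partial>lborel)"
    by (simp add: nn_integral_cmult)
  also have "\<dots> = ennreal K * (ennreal (1 / (t * (1 - l)) ^ DIM('a)) *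
      (\<integral>\<^sup>+y. \<integral>\<^sup>+z. \<Phi> (y, z) \<partial>lborel \<partial>lborel))"
    using t l by (subst nn_integral_segment_substitution) auto
  also have "(\<integral>\<^sup>+y. \<integral>\<^sup>+z. \<Phi> (y, z) \<partial>lborel \<partial>lborel) = energy"
    unfolding energy_def \<Phi>_def
    by (intro nn_integral_cong) (auto split: split_indicator)
  also have "ennreal K * (ennreal (1 / (t * (1 - l)) ^ DIM('a)) * energy)
      = ennreal (K * (1 / (t * (1 - l)) ^ DIM('a))) * energy"
    using K t l by (intro ennreal_mult_mult_left) auto
  also have "\<dots> \<le> ennreal (scale_const * t powr (2 * (s - \<alpha>))) * energy"
  proof (intro mult_right_mono ennreal_leI)
    have "1 / (t * (1 - l)) ^ DIM('a) \<le> 1 / (t * (1 / 2)) ^ DIM('a)"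
      using t l by (intro divide_left_mono power_mono mult_left_mono mult_pos_pos zero_less_power) auto
    also have "\<dots> = 2 ^ DIM('a) * t powr (- real DIM('a))"
      using t by (simp add: powr_minus powr_realpow field_simps)
    finally have "1 / (t * (1 - l)) ^ DIM('a) \<le> 2 ^ DIM('a) * t powr (- real DIM('a))" .
    then have "K * (1 / (t * (1 - l)) ^ DIM('a)) \<le> K * (2 ^ DIM('a) * t powr (- real DIM('a)))"
      using K by (rule mult_left_mono)
    also have "\<dots> = scale_const * (t powr ?p * t powr (- 2 * \<alpha>) * t powr (- real DIM('a)))"
    proof -
      have "(t * diameter S) powr ?p = t powr ?p * diameter S powr ?p"
        using t diameter_pos by (simp add: powr_mult)
      moreover have "(t * r / 4) powr (- 2 * \<alpha>) = t powr (- 2 * \<alpha>) * (r / 4) powr (- 2 * \<alpha>)"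
        using powr_mult[of t "r / 4" "- 2 * \<alpha>"] t r_pos by simp
      ultimately show ?thesis
        unfolding K_def scale_const_def by (simp only: mult_ac)
    qed
    also have "t powr ?p * t powr (- 2 * \<alpha>) * t powr (- real DIM('a)) = t powr (2 * (s - \<alpha>))"
      by (simp add: powr_add[symmetric] algebra_simps)
    finally show "K * (1 / (t * (1 - l)) ^ DIM('a)) \<le> scale_const * t powr (2 * (s - \<alpha>))" .
  qed simp
  finally show ?thesis .
qed

section \<open>Summation over dyadic scales\<close>

text \<open>The segment from \<open>x\<close> to \<open>(1 - t) x + t b\<close> is cut at its midpoint \<open>(1 - t / 2) x + (t / 2) b\<close>:
  the half next to \<open>x\<close> is the same quantity at scale \<open>t / 2\<close>, the other half stays away from the
  boundary and is covered by the estimate at a single scale.\<close>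
lemma oscillation_halving:
  assumes A [measurable]: "A \<in> sets borel" and AS: "A \<subseteq> S"
    and t: "0 < t" "t \<le> 1" and q: "1 < q"
  shows "oscillation A t \<le> ennreal q * oscillation A (t / 2)
    + ennreal (q / (q - 1) * (scale_const * t powr (2 * (s - \<alpha>)))) * energy"
proof -
  let ?z = "\<lambda>x b. (1 - t) *\<^sub>R x + t *\<^sub>R b"
  let ?y = "\<lambda>x b. (1 - t / 2) *\<^sub>R x + (t / 2) *\<^sub>R b"
  have mid: "(1 - 1 / 2) *\<^sub>R x + (1 / 2) *\<^sub>R ?z x b = ?y x b" for x b :: 'a
    by (rule euclidean_eqI) (simp add: inner_simps field_simps)
  have jump: "(\<integral>\<^sup>+x\<in>A. (\<integral>\<^sup>+b\<in>ball c (r / 2). ennreal ((f (?y x b) - f (?z x b))\<^sup>2) \<partial>lborel) \<partial>lborel)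
      \<le> ennreal (scale_const * t powr (2 * (s - \<alpha>))) * energy"
  proof (rule rescaled_difference_le_energy[OF A AS t, of "1 / 2", unfolded mid])
    fix x b assume xb: "x \<in> A" "b \<in> ball c (r / 2)"
    then show "?y x b \<in> S" "t * r / 4 \<le> bdist S (?y x b)"
      using segment_in[of x b "t / 2"] segment_bdist_ge[of x b "t / 2"] t AS by auto
  qed auto
  have "ennreal ((f x - f (?z x b))\<^sup>2) \<le> ennreal q * ennreal ((f x - f (?y x b))\<^sup>2)
      + ennreal (q / (q - 1)) * ennreal ((f (?y x b) - f (?z x b))\<^sup>2)" for x b
    using power2_add_le_weighted[OF q, of "f x - f (?y x b)" "f (?y x b) - f (?z x b)"] q
    by (simp add: ennreal_mult[symmetric] ennreal_plus[symmetric] ennreal_leI del: ennreal_plus)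
  then have "oscillation A t \<le> (\<integral>\<^sup>+x\<in>A. (\<integral>\<^sup>+b\<in>ball c (r / 2).
      (ennreal q * ennreal ((f x - f (?y x b))\<^sup>2)
        + ennreal (q / (q - 1)) * ennreal ((f (?y x b) - f (?z x b))\<^sup>2)) \<partial>lborel) \<partial>lborel)"
    unfolding oscillation_def by (intro nn_integral_mono mult_right_mono) auto
  also have "\<dots> = ennreal q * oscillation A (t / 2) + ennreal (q / (q - 1)) *
      (\<integral>\<^sup>+x\<in>A. (\<integral>\<^sup>+b\<in>ball c (r / 2). ennreal ((f (?y x b) - f (?z x b))\<^sup>2) \<partial>lborel) \<partial>lborel)"
    unfolding oscillation_def
    by (simp add: distrib_right mult.assoc nn_integral_add nn_integral_cmult)
  also have "\<dots> \<le> ennreal q * oscillation A (t / 2) + ennreal (q / (q - 1)) *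
      (ennreal (scale_const * t powr (2 * (s - \<alpha>))) * energy)"
    by (intro add_left_mono mult_left_mono jump) auto
  also have "\<dots> = ennreal q * oscillation A (t / 2)
      + ennreal (q / (q - 1) * (scale_const * t powr (2 * (s - \<alpha>)))) * energy"
    using q scale_const_nonneg by (subst ennreal_mult_mult_left) auto
  finally show ?thesis .
qed

text \<open>The square root of the decay factor between consecutive scales: passing from \<open>t\<close> to \<open>t / 2\<close>
  multiplies \<open>t\<^bsup>2\<sigma>\<^esup>\<close> by \<open>ratio\<^sup>2\<close>. Weighting the triangle inequality with \<open>q = 1 / ratio\<close> spends one factor \<open>ratio\<close> and leaves
  the other one for the geometric series.\<close>
definition ratio :: real where
  "ratio = 2 powr (\<alpha> - s)"

lemma ratio_bounds: "0 < ratio" "ratio < 1"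
  using \<alpha>_less powr_less_mono[of "\<alpha> - s" 0 2] by (auto simp: ratio_def)

definition deep_part :: "nat \<Rightarrow> 'a set" where
  "deep_part k = {x \<in> S. r * (1 / 2) ^ k \<le> bdist S x}"

lemma deep_part_borel [measurable]: "deep_part k \<in> sets borel"
  unfolding deep_part_def by measurable

text \<open>The constant \<open>N = scale_const / (1 - ratio)\<^sup>2\<close> is the fixed point of the recursion given by
  \<open>oscillation_halving\<close> with \<open>q = 1 / ratio\<close>, namely
  \<open>ratio * N + scale_const / (1 - ratio) = N\<close>. So the bound propagates from the finest scale \<open>j = k\<close>
  up to \<open>j = 0\<close> with a constant that does not depend on \<open>k\<close>.\<close>
lemma oscillation_deep_part_le:
  assumes "j \<le> k"
  shows "oscillation (deep_part k) ((1 / 2) ^ j)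
    \<le> ennreal (scale_const / (1 - ratio)\<^sup>2 * ((1 / 2) ^ j) powr (2 * (s - \<alpha>))) * energy"
  using assms
proof (induction j rule: inc_induct)
  case base
  let ?t = "(1 / 2) ^ k :: real"
  have "(\<integral>\<^sup>+x\<in>deep_part k. (\<integral>\<^sup>+b\<in>ball c (r / 2).
      ennreal ((f ((1 - 0) *\<^sub>R x + 0 *\<^sub>R ((1 - ?t) *\<^sub>R x + ?t *\<^sub>R b))
               - f ((1 - ?t) *\<^sub>R x + ?t *\<^sub>R b))\<^sup>2) \<partial>lborel) \<partial>lborel)
    \<le> ennreal (scale_const * ?t powr (2 * (s - \<alpha>))) * energy"
  proof (rule rescaled_difference_le_energy)
    fix x b assume "x \<in> deep_part k" "b \<in> ball c (r / 2)"
    moreover have "?t * r / 4 \<le> r * ?t" using r_pos by simp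
    ultimately have "?t * r / 4 \<le> bdist S x"
      unfolding deep_part_def by (blast intro: order_trans)
    then show "?t * r / 4 \<le> bdist S ((1 - 0) *\<^sub>R x + 0 *\<^sub>R ((1 - ?t) *\<^sub>R x + ?t *\<^sub>R b))"
      by simp
  qed (auto simp: deep_part_def power_le_one)
  then have "oscillation (deep_part k) ?t \<le> ennreal (scale_const * ?t powr (2 * (s - \<alpha>))) * energy"
    by (simp add: oscillation_def)
  also have "\<dots> \<le> ennreal (scale_const / (1 - ratio)\<^sup>2 * ?t powr (2 * (s - \<alpha>))) * energy"
  proof (intro mult_right_mono ennreal_leI)
    have "(1 - ratio)\<^sup>2 \<le> 1" using ratio_bounds by (intro power_le_one) auto
    then have "scale_const / 1 \<le> scale_const / (1 - ratio)\<^sup>2"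
      using ratio_bounds scale_const_nonneg by (intro divide_left_mono) auto
    then show "scale_const \<le> scale_const / (1 - ratio)\<^sup>2" by simp
  qed auto
  finally show ?case .
next
  case (step j)
  let ?t = "(1 / 2) ^ j :: real" and ?N = "scale_const / (1 - ratio)\<^sup>2"
  have N: "0 \<le> ?N" using scale_const_nonneg by simp
  have q: "1 < 1 / ratio" using ratio_bounds by simp
  have half: "(?t / 2) powr (2 * (s - \<alpha>)) = ratio\<^sup>2 * ?t powr (2 * (s - \<alpha>))"
  proof -
    have "(?t / 2) powr (2 * (s - \<alpha>)) = ?t powr (2 * (s - \<alpha>)) / 2 powr (2 * (s - \<alpha>))"
      by (simp add: powr_divide)
    also have "\<dots> = ratio\<^sup>2 * ?t powr (2 * (s - \<alpha>))"
      by (simp add: ratio_def power2_eq_square powr_add[symmetric] powr_minus_divide[symmetric]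
          divide_powr_uminus algebra_simps)
    finally show ?thesis .
  qed
  have "oscillation (deep_part k) ?t \<le> ennreal (1 / ratio) * oscillation (deep_part k) (?t / 2)
      + ennreal ((1 / ratio) / (1 / ratio - 1) * (scale_const * ?t powr (2 * (s - \<alpha>)))) * energy"
    by (rule oscillation_halving[OF _ _ _ _ q]) (auto simp: deep_part_def power_le_one)
  also have "\<dots> \<le> ennreal (1 / ratio) * (ennreal (?N * (?t / 2) powr (2 * (s - \<alpha>))) * energy)
      + ennreal ((1 / ratio) / (1 / ratio - 1) * (scale_const * ?t powr (2 * (s - \<alpha>)))) * energy"
    using step.IH by (intro add_right_mono mult_left_mono) (auto simp: mult.commute)
  also have "\<dots> = ennreal (1 / ratio * (?N * (?t / 2) powr (2 * (s - \<alpha>)))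
      + (1 / ratio) / (1 / ratio - 1) * (scale_const * ?t powr (2 * (s - \<alpha>)))) * energy"
  proof -
    have "0 \<le> (1 / ratio) / (1 / ratio - 1) * (scale_const * ?t powr (2 * (s - \<alpha>)))"
      using q scale_const_nonneg ratio_bounds
      by (intro mult_nonneg_nonneg divide_nonneg_nonneg) auto
    moreover have "0 \<le> 1 / ratio" "0 \<le> ?N * (?t / 2) powr (2 * (s - \<alpha>))"
      using ratio_bounds by (simp, intro mult_nonneg_nonneg[OF N] powr_ge_zero)
    ultimately show ?thesis
      by (simp only: ennreal_mult_mult_left ennreal_plus mult_nonneg_nonneg distrib_right)
  qed
  also have "1 / ratio * (?N * (?t / 2) powr (2 * (s - \<alpha>)))
      + (1 / ratio) / (1 / ratio - 1) * (scale_const * ?t powr (2 * (s - \<alpha>)))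
      = (1 / ratio * ratio\<^sup>2 * ?N + (1 / ratio) / (1 / ratio - 1) * scale_const)
        * ?t powr (2 * (s - \<alpha>))"
    unfolding half by (simp only: distrib_left distrib_right mult_ac)
  also have "1 / ratio * ratio\<^sup>2 * ?N + (1 / ratio) / (1 / ratio - 1) * scale_const = ?N"
  proof -
    have "(1 / ratio) / (1 / ratio - 1) * scale_const = (1 - ratio) * ?N"
    proof -
      have "(1 / ratio) / (1 / ratio - 1) = 1 / (1 - ratio)"
        using ratio_bounds by (simp add: field_simps)
      then show ?thesis using ratio_bounds by (simp add: power2_eq_square)
    qed
    moreover have "1 / ratio * ratio\<^sup>2 * ?N = ratio * ?N"
      using ratio_bounds by (simp add: power2_eq_square)
    ultimately show ?thesis by (simp only: distrib_right[symmetric]) simp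
  qed
  finally show ?case .
qed

lemma UN_deep_part: "(\<Union>k. deep_part k) = S"
proof
  show "S \<subseteq> (\<Union>k. deep_part k)"
  proof
    fix x assume x: "x \<in> S"
    then obtain e where e: "0 < e" "ball x e \<subseteq> S"
      using domain open_contains_ball unfolding bounded_domain_def by blast
    obtain k where "(1 / 2) ^ k < e / r"
      using e r_pos real_arch_pow_inv[of "e / r" "1 / 2"] by auto
    then have "r * (1 / 2) ^ k \<le> bdist S x"
      using bdist_ge_of_ball_subset[OF domain e(2)] r_pos
      by (simp add: less_divide_eq mult.commute)
    then show "x \<in> (\<Union>k. deep_part k)"
      using x by (auto simp: deep_part_def)
  qed
qed (auto simp: deep_part_def)

lemma incseq_deep_part: "incseq deep_part"
proof (rule incseq_SucI)
  fix k
  have "r * (1 / 2) ^ Suc k \<le> r * (1 / 2) ^ k"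
    using r_pos by simp
  then show "deep_part k \<subseteq> deep_part (Suc k)"
    unfolding deep_part_def by auto
qed

section \<open>The inequality for Borel functions\<close>

lemma oscillation_le_energy:
  "(\<integral>\<^sup>+x\<in>S. (\<integral>\<^sup>+b\<in>ball c (r / 2). ennreal ((f x - f b)\<^sup>2) \<partial>lborel) \<partial>lborel)
    \<le> ennreal (scale_const / (1 - ratio)\<^sup>2) * energy"
proof -
  \<comment> \<open>Monotone convergence in the domain of integration is continuity from below of this measure.\<close>
  define \<mu> where "\<mu> = density lborel
    (\<lambda>x. \<integral>\<^sup>+b\<in>ball c (r / 2). ennreal ((f x - f b)\<^sup>2) \<partial>lborel)"
  have \<mu>: "emeasure \<mu> A = (\<integral>\<^sup>+x\<in>A. (\<integral>\<^sup>+b\<in>ball c (r / 2). ennreal ((f x - f b)\<^sup>2) \<partial>lborel) \<partial>lborel)"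
    if "A \<in> sets borel" for A
    using that unfolding \<mu>_def by (subst emeasure_density) auto
  have "emeasure \<mu> (deep_part k) \<le> ennreal (scale_const / (1 - ratio)\<^sup>2) * energy" for k
    using oscillation_deep_part_le[of 0 k] by (simp add: \<mu> oscillation_def)
  then have "(SUP k. emeasure \<mu> (deep_part k)) \<le> ennreal (scale_const / (1 - ratio)\<^sup>2) * energy"
    by (rule SUP_least)
  also have "(SUP k. emeasure \<mu> (deep_part k)) = emeasure \<mu> S"
    using SUP_emeasure_incseq[OF _ incseq_deep_part, of \<mu>]
    by (simp add: \<mu>_def UN_deep_part image_subset_iff)
  finally show ?thesis by (simp add: \<mu>)
qed

text \<open>The hypothesis on \<open>I\<close> is used with \<open>a = f b\<close> and averaged over \<open>b\<close> in the ball of radius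
  \<open>r / 2\<close>. Its volume \<open>\<omega> (r / 2)\<^sup>n\<close> together with \<open>scale_const\<close> accounts for
  \<open>d\<^bsup>n + 2s\<^esup> r\<^bsup>- n - 2\<alpha>\<^esup> = (d / r)\<^bsup>n + 2\<alpha>\<^esup> d\<^bsup>2\<sigma>\<^esup>\<close>.\<close>
lemma variance_le_energy:
  assumes I: "0 \<le> I" "\<And>a. ennreal I \<le> (\<integral>\<^sup>+x\<in>S. ennreal ((f x - a)\<^sup>2) \<partial>lborel)"
  shows "ennreal I \<le> ennreal (4 powr (real DIM('a) + 2 * \<alpha>)
      / (unit_ball_vol (real DIM('a)) * (1 - 2 powr (\<alpha> - s))\<^sup>2)
      * (diameter S / r) powr (real DIM('a) + 2 * \<alpha>) * diameter S powr (2 * (s - \<alpha>))) * energy"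
proof -
  let ?B = "ball c (r / 2)" and ?\<omega> = "unit_ball_vol (real DIM('a))" and ?n = "real DIM('a)"
  define V where "V = ?\<omega> * (r / 2) ^ DIM('a)"
  have V_pos: "0 < V" using r_pos by (simp add: V_def)
  have "ennreal I * ennreal V = (\<integral>\<^sup>+b\<in>?B. ennreal I \<partial>lborel)"
    using r_pos by (simp add: V_def nn_integral_cmult_indicator emeasure_ball)
  also have "\<dots> \<le> (\<integral>\<^sup>+b\<in>?B. (\<integral>\<^sup>+x\<in>S. ennreal ((f x - f b)\<^sup>2) \<partial>lborel) \<partial>lborel)"
    by (intro nn_integral_mono mult_right_mono I) auto
  also have "\<dots> = (\<integral>\<^sup>+b. \<integral>\<^sup>+x. ennreal ((f x - f b)\<^sup>2) * indicator S x * indicator ?B b \<partial>lborel \<partial>lborel)"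
    by (simp add: nn_integral_multc)
  also have "\<dots> = (\<integral>\<^sup>+x. \<integral>\<^sup>+b. ennreal ((f x - f b)\<^sup>2) * indicator S x * indicator ?B b \<partial>lborel \<partial>lborel)"
    by (rule lborel_pair.Fubini') measurable
  also have "\<dots> = (\<integral>\<^sup>+x. \<integral>\<^sup>+b. (ennreal ((f x - f b)\<^sup>2) * indicator ?B b) * indicator S x \<partial>lborel \<partial>lborel)"
    by (simp add: mult_ac)
  also have "\<dots> = (\<integral>\<^sup>+x\<in>S. (\<integral>\<^sup>+b\<in>?B. ennreal ((f x - f b)\<^sup>2) \<partial>lborel) \<partial>lborel)"
    by (simp add: nn_integral_multc)
  also have "\<dots> \<le> ennreal (scale_const / (1 - ratio)\<^sup>2) * energy"
    by (rule oscillation_le_energy)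
  finally have "ennreal (1 / V) * (ennreal I * ennreal V)
      \<le> ennreal (1 / V) * (ennreal (scale_const / (1 - ratio)\<^sup>2) * energy)"
    by (rule mult_left_mono) simp
  moreover have "ennreal (1 / V) * (ennreal I * ennreal V) = ennreal I"
    using V_pos I(1) by (simp add: ennreal_mult[symmetric])
  moreover have "ennreal (1 / V) * (ennreal (scale_const / (1 - ratio)\<^sup>2) * energy)
      = ennreal (1 / V * (scale_const / (1 - ratio)\<^sup>2)) * energy"
    using V_pos scale_const_nonneg by (intro ennreal_mult_mult_left) auto
  moreover have "1 / V * (scale_const / (1 - ratio)\<^sup>2)
      = 4 powr (?n + 2 * \<alpha>) / (?\<omega> * (1 - ratio)\<^sup>2)
        * (diameter S / r) powr (?n + 2 * \<alpha>) * diameter S powr (2 * (s - \<alpha>))"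
  proof -
    have "scale_const / (r / 2) ^ DIM('a)
        = 4 powr (?n + 2 * \<alpha>) * (diameter S / r) powr (?n + 2 * \<alpha>) * diameter S powr (2 * (s - \<alpha>))"
    proof -
      have "scale_const / (r / 2) ^ DIM('a)
          = 4 ^ DIM('a) / (r ^ DIM('a)) * diameter S powr (?n + 2 * s) * (r / 4) powr (- 2 * \<alpha>)"
        using r_pos by (simp add: scale_const_def power_divide power_mult_distrib[symmetric])
      also have "(4::real) ^ DIM('a) = 4 powr ?n" by (simp add: powr_realpow)
      also have "r ^ DIM('a) = r powr ?n" using r_pos by (simp add: powr_realpow)
      also have "(r / 4) powr (- 2 * \<alpha>) = 4 powr (2 * \<alpha>) / r powr (2 * \<alpha>)"
        using r_pos by (simp add: powr_minus powr_divide field_simps)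
      also have "diameter S powr (?n + 2 * s)
          = diameter S powr (?n + 2 * \<alpha>) * diameter S powr (2 * (s - \<alpha>))"
        by (simp add: powr_add[symmetric] algebra_simps)
      also have "4 powr ?n / r powr ?n * (diameter S powr (?n + 2 * \<alpha>) * diameter S powr (2 * (s - \<alpha>)))
          * (4 powr (2 * \<alpha>) / r powr (2 * \<alpha>))
        = (4 powr ?n * 4 powr (2 * \<alpha>)) * (diameter S powr (?n + 2 * \<alpha>) / (r powr ?n * r powr (2 * \<alpha>)))
          * diameter S powr (2 * (s - \<alpha>))"
        by simp
      also have "\<dots> = 4 powr (?n + 2 * \<alpha>) * (diameter S / r) powr (?n + 2 * \<alpha>)
          * diameter S powr (2 * (s - \<alpha>))"
        using r_pos diameter_pos by (simp add: powr_add[symmetric] powr_divide)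
      finally show ?thesis .
    qed
    moreover have "1 / V * (scale_const / (1 - ratio)\<^sup>2)
        = scale_const / (r / 2) ^ DIM('a) / (?\<omega> * (1 - ratio)\<^sup>2)"
      by (simp add: V_def)
    ultimately show ?thesis by simp
  qed
  ultimately show ?thesis by (simp add: ratio_def)
qed

end

section \<open>Passage to Lebesgue measurable functions\<close>

lemma borel_representative_on:
  fixes v :: "'a::euclidean_space \<Rightarrow> real"
  assumes S: "S \<in> sets borel" and v: "v \<in> borel_measurable (lebesgue_on S)"
  obtains f where "f \<in> borel_measurable borel" "AE x in lebesgue_on S. v x = f x"
proof -
  have "(\<lambda>x. if x \<in> S then v x else 0) \<in> borel_measurable lebesgue"
    using v S borel_measurable_if[of S v] by simp
  then obtain f where "f \<in> borel_measurable lborel" "AE x in lborel. (if x \<in> S then v x else 0) = f x"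
    using completion_ex_borel_measurable_real by blast
  then have "f \<in> borel_measurable borel" "AE x in lebesgue_on S. v x = f x"
    using S by (auto simp: AE_restrict_space_iff AE_completion_iff elim!: eventually_mono split: if_splits)
  then show ?thesis using that by blast
qed

lemma nn_integral_lebesgue_on_eq:
  assumes "S \<in> sets borel"
  shows "(\<integral>\<^sup>+x. g x \<partial>lebesgue_on S) = (\<integral>\<^sup>+x\<in>S. g x \<partial>lborel)"
  using assms by (simp add: nn_integral_restrict_space nn_integral_completion)

text \<open>By Tonelli's theorem the double integral is iterated, and in each of the two integrations
  \<open>v\<close> may be replaced by \<open>f\<close> and Lebesgue by Borel measure.\<close>
lemma (in star_domain) Hs_seminorm_sq_eq_energy:
  assumes v [measurable]: "v \<in> borel_measurable (lebesgue_on S)"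
    and ae: "AE x in lebesgue_on S. v x = f x"
  shows "Hs_seminorm_sq s \<alpha> S v = energy"
proof -
  let ?L = "lebesgue_on S"
  interpret L: finite_measure ?L
    using domain by (intro finite_measure_lebesgue_on) (auto simp: bounded_domain_def intro: lmeasurable_open)
  have id [measurable]: "(\<lambda>x. x) \<in> ?L \<rightarrow>\<^sub>M borel"
    by (intro measurable_restrict_space1 measurable_completion) auto
  define k where "k = (\<lambda>(x, y). ennreal (\<bar>v x - v y\<bar>\<^sup>2 / norm (x - y) powr (real DIM('a) + 2 * s)
                          * bdist2 S x y powr (2 * \<alpha>)))"
  have k: "k \<in> borel_measurable (?L \<Otimes>\<^sub>M ?L)"
    unfolding k_def bdist2_def by measurable
  have "Hs_seminorm_sq s \<alpha> S v = (\<integral>\<^sup>+x. \<integral>\<^sup>+y. k (x, y) \<partial>?L \<partial>?L)"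
    unfolding L.nn_integral_fst[OF k] by (simp add: Hs_seminorm_sq_def k_def)
  also have "\<dots> = (\<integral>\<^sup>+x. \<integral>\<^sup>+y. kernel (x, y) \<partial>?L \<partial>?L)"
  proof (rule nn_integral_cong_AE, use ae in eventually_elim)
    fix x assume x: "v x = f x"
    show "(\<integral>\<^sup>+y. k (x, y) \<partial>?L) = (\<integral>\<^sup>+y. kernel (x, y) \<partial>?L)"
      by (rule nn_integral_cong_AE, use ae in eventually_elim) (simp add: x k_def kernel_def)
  qed
  also have "\<dots> = energy"
    by (simp add: nn_integral_lebesgue_on_eq energy_def)
  finally show ?thesis .
qed

lemma L2_norm_sq_le_Hs_seminorm_sq:
  fixes S :: "'a::euclidean_space set"
  assumes \<alpha>: "0 \<le> \<alpha>" "\<alpha> < s" and S: "bounded_domain S" "0 < r" "star_shaped_wrt S (ball c r)"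
    and L2: "L2_on S v" and mean: "(\<integral>x. v x \<partial>lebesgue_on S) = 0"
  shows "ennreal (\<integral>x. (v x)\<^sup>2 \<partial>lebesgue_on S) \<le> ennreal (4 powr (real DIM('a) + 2 * \<alpha>)
      / (unit_ball_vol (real DIM('a)) * (1 - 2 powr (\<alpha> - s))\<^sup>2)
      * (diameter S / r) powr (real DIM('a) + 2 * \<alpha>) * diameter S powr (2 * (s - \<alpha>)))
    * Hs_seminorm_sq s \<alpha> S v"
proof -
  have S_borel: "S \<in> sets borel" using S by (simp add: bounded_domain_def)
  have v: "v \<in> borel_measurable (lebesgue_on S)" and v2: "integrable (lebesgue_on S) (\<lambda>x. (v x)\<^sup>2)"
    using L2 by (auto simp: L2_on_def)
  obtain f where f: "f \<in> borel_measurable borel" and ae: "AE x in lebesgue_on S. v x = f x"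
    using borel_representative_on[OF S_borel v] by blast
  interpret star_domain S c r s \<alpha> f
    using \<alpha> S f by unfold_locales
  have fin: "finite_measure (lebesgue_on S)"
    using S by (intro finite_measure_lebesgue_on) (auto simp: bounded_domain_def intro: lmeasurable_open)
  have "ennreal (\<integral>x. (v x)\<^sup>2 \<partial>lebesgue_on S) \<le> (\<integral>\<^sup>+x\<in>S. ennreal ((f x - a)\<^sup>2) \<partial>lborel)" for a
  proof -
    have "ennreal (\<integral>x. (v x)\<^sup>2 \<partial>lebesgue_on S) \<le> (\<integral>\<^sup>+x. ennreal ((v x - a)\<^sup>2) \<partial>lebesgue_on S)"
      by (rule nn_integral_variance_ge[OF fin v v2 mean])
    also have "\<dots> = (\<integral>\<^sup>+x. ennreal ((f x - a)\<^sup>2) \<partial>lebesgue_on S)"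
      by (rule nn_integral_cong_AE, use ae in eventually_elim) simp
    finally show ?thesis by (simp add: nn_integral_lebesgue_on_eq S_borel)
  qed
  then show ?thesis
    unfolding Hs_seminorm_sq_eq_energy[OF v ae] by (intro variance_le_energy) auto
qed

theorem proposition4p7:
  fixes s \<alpha> :: real
  assumes "0 < s" and "s < 1" and "0 \<le> \<alpha>" and "\<alpha> < s"
  shows "\<exists>C :: real \<Rightarrow> real. (\<forall>\<kappa>. 0 < C \<kappa>) \<and>
    (\<forall>(S :: 'a::euclidean_space set) B c r v.
       bounded_domain S \<longrightarrow> 0 < r \<longrightarrow> B = ball c r \<longrightarrow> star_shaped_wrt S B \<longrightarrow>
       L2_on S v \<longrightarrow> (\<integral>x. v x \<partial>lebesgue_on S) = 0 \<longrightarrow>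
       ennreal (L2_norm_on S v)
         \<le> ennreal (C (chunkiness S B) * diameter S powr (s - \<alpha>)) * Hs_seminorm s \<alpha> S v)"
proof -
  let ?p = "real DIM('a) + 2 * \<alpha>"
  define P where "P = 4 powr ?p / (unit_ball_vol (real DIM('a)) * (1 - 2 powr (\<alpha> - s))\<^sup>2)"
  have "2 powr (\<alpha> - s) < 1"
    using assms powr_less_mono[of "\<alpha> - s" 0 2] by simp
  then have P: "0 < P"
    unfolding P_def by (intro divide_pos_pos mult_pos_pos zero_less_power) auto
  \<comment> \<open>Here \<open>d / r = 2 * chunkiness S B\<close>, the diameter of \<open>B\<close> being \<open>2 * r\<close>; the maximum with \<open>1\<close>
     makes \<open>C\<close> positive also at arguments that are not chunkiness parameters.\<close>
  define C where "C = (\<lambda>\<kappa>. sqrt (P * max 1 (2 * \<kappa>) powr ?p))"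
  have C_pos: "0 < C \<kappa>" for \<kappa>
    using P by (simp add: C_def)
  have "ennreal (L2_norm_on S v)
         \<le> ennreal (C (chunkiness S B) * diameter S powr (s - \<alpha>)) * Hs_seminorm s \<alpha> S v"
    if S: "bounded_domain S" and r: "0 < r" and B: "B = ball c r" and star: "star_shaped_wrt S B"
      and v: "L2_on S v" "(\<integral>x. v x \<partial>lebesgue_on S) = 0"
    for S B :: "'a set" and c r v
  proof (cases "Hs_seminorm_sq s \<alpha> S v = \<infinity>")
    case True
    have BS: "B \<subseteq> S" using star by (simp add: star_shaped_wrt_def)
    then have "2 * r \<le> diameter S"
      using diameter_subset[OF BS] S B r by (simp add: bounded_domain_def)
    then have "ennreal (C (chunkiness S B) * diameter S powr (s - \<alpha>)) \<noteq> 0"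
      using C_pos[of "chunkiness S B"] r by (simp add: not_le)
    then show ?thesis
      using True by (simp add: Hs_seminorm_def ennreal_mult_top)
  next
    case False
    have d: "0 \<le> diameter S"
      using S by (simp add: bounded_domain_def diameter_ge_0)
    define h where "h = enn2real (Hs_seminorm_sq s \<alpha> S v)"
    have h: "Hs_seminorm_sq s \<alpha> S v = ennreal h" "0 \<le> h"
      using False by (auto simp: h_def less_top)
    let ?Z = "P * (diameter S / r) powr ?p * diameter S powr (2 * (s - \<alpha>))"
    have "ennreal (\<integral>x. (v x)\<^sup>2 \<partial>lebesgue_on S) \<le> ennreal ?Z * ennreal h"
      using L2_norm_sq_le_Hs_seminorm_sq[OF assms(3,4) S r star[unfolded B] v]
      unfolding h(1) P_def .
    then have "(\<integral>x. (v x)\<^sup>2 \<partial>lebesgue_on S) \<le> ?Z * h"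
      using P h(2) by (simp add: ennreal_mult[symmetric])
    then have "L2_norm_on S v \<le> sqrt (?Z * h)"
      unfolding L2_norm_on_def by (rule real_sqrt_le_mono)
    also have "\<dots> \<le> sqrt (P * max 1 (2 * chunkiness S B) powr ?p * diameter S powr (2 * (s - \<alpha>)) * h)"
      using P h(2) B r assms d
      by (intro real_sqrt_le_mono mult_right_mono mult_left_mono powr_mono2)
         (auto simp: chunkiness_def)
    also have "\<dots> = C (chunkiness S B) * diameter S powr (s - \<alpha>) * sqrt h"
    proof -
      have "diameter S powr (2 * (s - \<alpha>)) = (diameter S powr (s - \<alpha>))\<^sup>2"
        by (simp add: power2_eq_square powr_add[symmetric])
      then have "sqrt (diameter S powr (2 * (s - \<alpha>))) = diameter S powr (s - \<alpha>)"
        by (simp only: real_sqrt_abs) simp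
      then show ?thesis by (simp add: C_def real_sqrt_mult)
    qed
    finally have "ennreal (L2_norm_on S v)
        \<le> ennreal (C (chunkiness S B) * diameter S powr (s - \<alpha>) * sqrt h)"
      by (rule ennreal_leI)
    then show ?thesis
      using False C_pos[of "chunkiness S B"] h(2)
      by (simp add: Hs_seminorm_def ennreal_mult less_imp_le flip: h_def)
  qed
  then show ?thesis using C_pos by (intro exI[of _ C]) blast
qed

end
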